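(* Let $\pi$ be a probability distribution on $\mathbb{R}$ with mean $0$ and variance $1$, let $\mathcal{X}=\mathrm{iid}(\pi)$, and let $\lambda\ge0$. Let $P_n=\mathrm{GWig}_n(\lambda,\mathcal{X})$ and $Q_n=\mathrm{GWig}_n(0)$. Suppose that the product $\pi\pi'$ of two independent random variables with distribution $\pi$ is sub-Gaussian with variance proxy $\sigma^2$ (with $\sigma>0$). If $\lambda<\frac1\sigma$, then $$\lim_{n\to\infty}\mathbb{E}_{Q_n}\left[\left(\frac{dP_n}{dQ_n}\right)^2\right]=(1-\lambda^2)^{-1/2}<\infty,$$ and consequently $P_n$ is contiguous to $Q_n$.
   Context: For a distribution $\pi$ on $\mathbb{R}$ with mean $0$ and variance $1$, $\mathrm{iid}(\pi)$ denotes the family of distributions $\{\mathcal{X}_n\}$ in which the coordinates of $x\in\mathbb{R}^n$ are independent, each distributed as $\frac{1}{\sqrt n}\pi$. For $\lambda\ge0$, $\mathrm{GWig}_n(\lambda,\mathcal{X})$ is the law of the $n\times n$ matrix $Y=\lambda xx^\top+\frac{1}{\sqrt n}W$, where $x\sim\mathcal{X}_n$ and, independently of $x$, $W$ is an $n\times n$ GOE matrix: random symmetric, off-diagonal entries $\mathcal{N}(0,1)$, diagonal entries $\mathcal{N}(0,2)$, all entries independent except for $W_{ij}=W_{ji}$. $\mathrm{GWig}_n(0)$ denotes the case $\lambda=0$. A real random variable $X$ is sub-Gaussian with variance proxy $\sigma^2$ if $\mathbb{E}[X]=0$ and $\mathbb{E}\exp(tX)\le\exp(\frac12\sigma^2t^2)$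 for all $t\in\mathbb{R}$. Contiguity: for sequences of probability measures $P_n,Q_n$ on measurable spaces $(\Omega_n,\mathcal{F}_n)$, $P_n$ is contiguous to $Q_n$ if for every sequence of events $A_n\in\mathcal{F}_n$, $Q_n(A_n)\to0$ implies $P_n(A_n)\to0$ as $n\to\infty$. *)

theory Defs
  imports "HOL-Probability.Probability"
begin

(* Vectors in R^n are elements of the product space over {..<n}, and n x n matrices are elements
   of the product space over {..<n} x {..<n}; both are extensional functions
   (value undefined off the index set). *)

definition vec_space :: "nat \<Rightarrow> (nat \<Rightarrow> real) measure" where
  "vec_space n = (\<Pi>\<^sub>M i\<in>{..<n}. borel)"

definition mat_space :: "nat \<Rightarrow> (nat \<times> nat \<Rightarrow> real) measure" where
  "mat_space n = (\<Pi>\<^sub>M ij\<in>{..<n} \<times> {..<n}. borel)"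

definition iid_prior :: "real measure \<Rightarrow> nat \<Rightarrow> (nat \<Rightarrow> real) measure" where
  "iid_prior \<pi> n = (\<Pi>\<^sub>M i\<in>{..<n}. distr \<pi> borel (\<lambda>t. t / sqrt (real n)))"

definition upper_index :: "nat \<Rightarrow> (nat \<times> nat) set" where
  "upper_index n = {(i, j). i \<le> j \<and> j < n}"

(* normal_density takes the standard deviation, so sqrt 2 gives diagonal variance 2. *)
definition goe_upper :: "nat \<Rightarrow> (nat \<times> nat \<Rightarrow> real) measure" where
  "goe_upper n = (\<Pi>\<^sub>M ij\<in>upper_index n.
     density lborel (\<lambda>w. ennreal (normal_density 0 (if fst ij = snd ij then sqrt 2 else 1) w)))"

definition goe :: "nat \<Rightarrow> (nat \<times> nat \<Rightarrow> real) measure" where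
  "goe n = distr (goe_upper n) (mat_space n)
     (\<lambda>w. \<lambda>(i, j)\<in>{..<n} \<times> {..<n}. w (min i j, max i j))"

definition gwig :: "nat \<Rightarrow> real \<Rightarrow> (nat \<Rightarrow> (nat \<Rightarrow> real) measure) \<Rightarrow> (nat \<times> nat \<Rightarrow> real) measure" where
  "gwig n l \<X> = distr (\<X> n \<Otimes>\<^sub>M goe n) (mat_space n)
     (\<lambda>(x, W). \<lambda>(i, j)\<in>{..<n} \<times> {..<n}. l * (x i * x j) + W (i, j) / sqrt (real n))"

definition subgaussian :: "'a measure \<Rightarrow> ('a \<Rightarrow> real) \<Rightarrow> real \<Rightarrow> bool" where
  "subgaussian M X v \<longleftrightarrow>
     X \<in> borel_measurable M \<and> integrable M X \<and> (\<integral>\<omega>. X \<omega> \<partial>M) = 0 \<and>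
     (\<forall>t. integrable M (\<lambda>\<omega>. exp (t * X \<omega>)) \<and>
          (\<integral>\<omega>. exp (t * X \<omega>) \<partial>M) \<le> exp (1 / 2 * v * t\<^sup>2))"

definition contiguous :: "(nat \<Rightarrow> 'a measure) \<Rightarrow> (nat \<Rightarrow> 'a measure) \<Rightarrow> bool" where
  "contiguous P Q \<longleftrightarrow>
     (\<forall>n. sets (P n) = sets (Q n)) \<and>
     (\<forall>A. (\<forall>n. A n \<in> sets (Q n)) \<longrightarrow>
          (\<lambda>n. measure (Q n) (A n)) \<longlonglongrightarrow> 0 \<longrightarrow>
          (\<lambda>n. measure (P n) (A n)) \<longlonglongrightarrow> 0)"

(* The second moment of dP/dQ under Q, in [0, infinity]. RN_deriv Q P is meaningful only when
   P is absolutely continuous with respect to Q. *)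
definition lr_second_moment :: "'a measure \<Rightarrow> 'a measure \<Rightarrow> ennreal" where
  "lr_second_moment P Q = (\<integral>\<^sup>+ Y. (RN_deriv Q P Y)\<^sup>2 \<partial>Q)"

lemma upper_index_measurable:
  "(\<lambda>w. \<lambda>(i, j)\<in>{..<n} \<times> {..<n}. w (min i j, max i j)) \<in> goe_upper n \<rightarrow>\<^sub>M mat_space n"
  unfolding mat_space_def
proof (rule measurable_restrict, clarsimp)
  fix i j assume "i < n" "j < n"
  then have "(min i j, max i j) \<in> upper_index n" by (auto simp: upper_index_def)
  from measurable_component_singleton[OF this,
      of "\<lambda>ij. density lborel (\<lambda>w. ennreal (normal_density 0 (if fst ij = snd ij then sqrt 2 else 1) w))"]
  show "(\<lambda>w. w (min i j, max i j)) \<in> borel_measurable (goe_upper n)"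
    unfolding goe_upper_def by simp
qed

lemma prob_space_goe: "prob_space (goe n)"
  unfolding goe_def
proof (rule prob_space.prob_space_distr[OF _ upper_index_measurable])
  show "prob_space (goe_upper n)"
    unfolding goe_upper_def by (intro prob_space_PiM prob_space_normal_density) auto
qed

lemma sets_goe [simp, measurable_cong]: "sets (goe n) = sets (mat_space n)"
  by (simp add: goe_def)

lemma prob_space_iid_prior:
  assumes "prob_space \<pi>" "sets \<pi> = sets borel"
  shows "prob_space (iid_prior \<pi> n)"
  unfolding iid_prior_def
  by (intro prob_space_PiM prob_space.prob_space_distr assms(1))
     (simp add: measurable_cong_sets[OF assms(2) refl])

lemma sets_iid_prior [simp, measurable_cong]: "sets (iid_prior \<pi> n) = sets (vec_space n)"
  unfolding iid_prior_def vec_space_def by (rule sets_PiM_cong) auto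

lemma gwig_measurable:
  assumes [simp, measurable_cong]: "sets (\<X> n) = sets (vec_space n)"
  shows "(\<lambda>(x, W). \<lambda>(i, j)\<in>{..<n} \<times> {..<n}. l * (x i * x j) + W (i, j) / sqrt (real n))
           \<in> \<X> n \<Otimes>\<^sub>M goe n \<rightarrow>\<^sub>M mat_space n"
proof -
  have v: "(\<lambda>x. x i) \<in> borel_measurable (\<X> n)" if "i < n" for i
    using that measurable_component_singleton[of i "{..<n}" "\<lambda>_. borel :: real measure"]
    by (simp add: vec_space_def measurable_cong_sets[OF assms refl])
  have m: "(\<lambda>W. W (i, j)) \<in> borel_measurable (goe n)" if "i < n" "j < n" for i j
    using that measurable_component_singleton[of "(i, j)" "{..<n} \<times> {..<n}" "\<lambda>_. borel :: real measure"]
    by (simp add: mat_space_def measurable_cong_sets[OF sets_goe refl])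
  have "(\<lambda>p. l * (fst p i * fst p j) + snd p (i, j) / sqrt (real n))
          \<in> borel_measurable (\<X> n \<Otimes>\<^sub>M goe n)" if "i < n" "j < n" for i j
    using measurable_compose[OF measurable_fst v] measurable_compose[OF measurable_snd m] that
    by (intro borel_measurable_add borel_measurable_times borel_measurable_divide) auto
  then show ?thesis
    unfolding mat_space_def split_beta by (intro measurable_restrict) auto
qed

lemma prob_space_gwig:
  assumes "prob_space (\<X> n)" "sets (\<X> n) = sets (vec_space n)"
  shows "prob_space (gwig n l \<X>)"
proof -
  interpret pair_prob_space "\<X> n" "goe n"
    using assms(1) prob_space_goe by (simp add: pair_prob_space_def pair_sigma_finite_def prob_space_imp_sigma_finite)
  show ?thesis
    unfolding gwig_def by (rule prob_space_distr[OF gwig_measurable[where n = n and \<X> = \<X>, OF assms(2)]])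
qed

lemma sets_gwig [simp, measurable_cong]: "sets (gwig n l \<X>) = sets (mat_space n)"
  by (simp add: gwig_def)

(* For l = 0 the law does not depend on the prior. *)
lemma gwig_0:
  assumes "prob_space (\<X> n)" "sets (\<X> n) = sets (vec_space n)"
  shows "gwig n 0 \<X> = distr (goe n) (mat_space n)
           (\<lambda>W. \<lambda>ij\<in>{..<n} \<times> {..<n}. W ij / sqrt (real n))"
proof -
  interpret pair_prob_space "\<X> n" "goe n"
    using assms(1) prob_space_goe by (simp add: pair_prob_space_def pair_sigma_finite_def prob_space_imp_sigma_finite)
  have m: "(\<lambda>W. \<lambda>ij\<in>{..<n} \<times> {..<n}. W ij / sqrt (real n)) \<in> goe n \<rightarrow>\<^sub>M mat_space n"
    unfolding measurable_cong_sets[OF sets_goe refl] mat_space_def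
    by (intro measurable_restrict borel_measurable_divide measurable_component_singleton) auto
  have "gwig n 0 \<X> = distr (\<X> n \<Otimes>\<^sub>M goe n) (mat_space n)
          ((\<lambda>W. \<lambda>ij\<in>{..<n} \<times> {..<n}. W ij / sqrt (real n)) \<circ> snd)"
    unfolding gwig_def by (intro distr_cong) (auto simp: fun_eq_iff restrict_def)
  also have "\<dots> = distr (distr (\<X> n \<Otimes>\<^sub>M goe n) (goe n) snd) (mat_space n)
          (\<lambda>W. \<lambda>ij\<in>{..<n} \<times> {..<n}. W ij / sqrt (real n))"
    by (rule distr_distr[symmetric, OF m]) auto
  also have "distr (\<X> n \<Otimes>\<^sub>M goe n) (goe n) snd = goe n"
    by (subst distr_pair_swap)
       (simp add: distr_distr comp_def split_beta prob_space.distr_pair_fst[OF assms(1)])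
  finally show ?thesis .
qed

end

theory Submission
  imports Defs "HOL-Real_Asymp.Real_Asymp"
begin

text \<open>
  Conditionally on the signal $x$, the observation is a shifted Gaussian vector, so the likelihood
  ratio is the average over $x$ of the Gaussian shift densities. Squaring it introduces an
  independent copy $x'$, and integrating out the noise gives
  $E_{Q_n} (dP_n/dQ_n)^2 = E \exp(\frac{n}{2} \lambda^2 \langle x, x'\rangle^2)$.
  The square is linearised by an auxiliary standard Gaussian $g$, which makes the coordinates
  factorise: the second moment equals $E_g [M(\lambda g / \sqrt n)^n]$, where $M$ is the moment
  generating function of $\pi\pi'$. Since $M(s) = 1 + s^2/2 + o(s^2)$, the integrand tends to
  $\exp(\lambda^2 g^2/2)$; it is dominated by $\exp(\sigma^2\lambda^2 g^2/2)$, which is integrable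
  because $\sigma\lambda < 1$. The same pointwise limit shows $\sigma \ge 1$, hence $\lambda < 1$.
  Contiguity follows from the bounded second moments through $K L \le K^2 + L^2$.
\<close>

subsection \<open>Shifted Gaussian vectors\<close>

text \<open>Completing the square: tilting a Gaussian by \<open>exp (c * x)\<close> moves its mean
  by \<open>c * s\<^sup>2\<close> and leaves its moment generating function as a constant. Both the
  shift densities and the linearisation of the squared overlap rest on this identity.\<close>

lemma exp_mult_normal_density:
  fixes s :: real
  assumes "0 < s"
  shows "normal_density a s x * exp (c * x) = exp (a * c + c\<^sup>2 * s\<^sup>2 / 2) * normal_density (a + c * s\<^sup>2) s x"
proof -
  have "- (x - a)\<^sup>2 / (2 * s\<^sup>2) + c * x = a * c + c\<^sup>2 * s\<^sup>2 / 2 + - (x - (a + c * s\<^sup>2))\<^sup>2 / (2 * s\<^sup>2)"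
    using assms by (simp add: field_simps power2_eq_square)
  then have "exp (- (x - a)\<^sup>2 / (2 * s\<^sup>2)) * exp (c * x) =
      exp (a * c + c\<^sup>2 * s\<^sup>2 / 2) * exp (- (x - (a + c * s\<^sup>2))\<^sup>2 / (2 * s\<^sup>2))"
    by (simp only: exp_add[symmetric])
  then show ?thesis
    by (simp add: normal_density_def)
qed

lemma nn_integral_normal_density:
  "0 < s \<Longrightarrow> (\<integral>\<^sup>+x. ennreal (normal_density a s x) \<partial>lborel) = 1"
  by (subst nn_integral_eq_integral) auto

lemma nn_integral_exp_normal_density:
  assumes "0 < s"
  shows "(\<integral>\<^sup>+x. ennreal (normal_density a s x) * ennreal (exp (c * x)) \<partial>lborel)
           = ennreal (exp (a * c + c\<^sup>2 * s\<^sup>2 / 2))"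
  using assms
  by (simp add: ennreal_mult'[symmetric] exp_mult_normal_density nn_integral_normal_density)
     (simp add: ennreal_mult' nn_integral_cmult nn_integral_normal_density)

lemma distr_normal_density_shift:
  "distr (density lborel (\<lambda>x. ennreal (normal_density a s x))) borel (\<lambda>x. x + m)
     = density lborel (\<lambda>x. ennreal (normal_density (a + m) s x))"
proof -
  have "distr (density lborel (\<lambda>x. ennreal (normal_density (a + m) s (x + m)))) lborel (\<lambda>x. x + m)
      = density (distr lborel lborel (\<lambda>x. x + m)) (\<lambda>x. ennreal (normal_density (a + m) s x))"
    by (subst density_distr) auto
  moreover have "distr lborel lborel (\<lambda>x. x + m) = (lborel :: real measure)"
    using lborel_distr_plus[of m] by (simp add: add.commute cong: distr_cong)
  moreover have "normal_density (a + m) s (x + m) = normal_density a s x" for x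
    by (simp add: normal_density_def)
  ultimately show ?thesis
    by (simp cong: distr_cong)
qed

text \<open>Finite products are determined by boxes, and on a box both the density and the indicator
  split over the coordinates. Sigma-finiteness is asked at every index, as
  \<open>product_sigma_finite\<close> demands.\<close>

lemma density_PiM:
  assumes "finite I" "\<And>i. sigma_finite_measure (M i)"
    and "\<And>i. sigma_finite_measure (density (M i) (f i))"
    and [measurable]: "\<And>i. i \<in> I \<Longrightarrow> f i \<in> borel_measurable (M i)"
  shows "density (PiM I M) (\<lambda>x. \<Prod>i\<in>I. f i (x i)) = PiM I (\<lambda>i. density (M i) (f i))"
proof -
  interpret product_sigma_finite M
    using assms by (simp add: product_sigma_finite_def)
  interpret D: product_sigma_finite "\<lambda>i. density (M i) (f i)"
    using assms by (simp add: product_sigma_finite_def)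
  show ?thesis
  proof (rule D.PiM_eqI)
    fix A assume A: "\<And>i. i \<in> I \<Longrightarrow> A i \<in> sets (density (M i) (f i))"
    then have [measurable]: "Pi\<^sub>E I A \<in> sets (PiM I M)"
      using \<open>finite I\<close> by (auto intro!: sets_PiM_I_finite)
    have "emeasure (density (PiM I M) (\<lambda>x. \<Prod>i\<in>I. f i (x i))) (Pi\<^sub>E I A)
        = (\<integral>\<^sup>+x. (\<Prod>i\<in>I. f i (x i)) * indicator (Pi\<^sub>E I A) x \<partial>PiM I M)"
      by (subst emeasure_density) auto
    also have "\<dots> = (\<integral>\<^sup>+x. (\<Prod>i\<in>I. f i (x i) * indicator (A i) (x i)) \<partial>PiM I M)"
    proof (rule nn_integral_cong)
      fix x assume "x \<in> space (PiM I M)"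
      then have "x \<in> Pi\<^sub>E I A \<longleftrightarrow> (\<forall>i\<in>I. x i \<in> A i)"
        by (auto simp: space_PiM PiE_def Pi_def)
      then have "indicator (Pi\<^sub>E I A) x = (\<Prod>i\<in>I. indicator (A i) (x i) :: ennreal)"
        using \<open>finite I\<close> by (auto simp: indicator_def prod_zero_iff)
      then show "(\<Prod>i\<in>I. f i (x i)) * indicator (Pi\<^sub>E I A) x = (\<Prod>i\<in>I. f i (x i) * indicator (A i) (x i))"
        by (simp add: prod.distrib)
    qed
    also have "\<dots> = (\<Prod>i\<in>I. \<integral>\<^sup>+x. f i x * indicator (A i) x \<partial>M i)"
      using A \<open>finite I\<close> by (intro product_nn_integral_prod) auto
    also have "\<dots> = (\<Prod>i\<in>I. emeasure (density (M i) (f i)) (A i))"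
      using A by (intro prod.cong refl) (simp add: emeasure_density)
    finally show "emeasure (density (PiM I M) (\<lambda>x. \<Prod>i\<in>I. f i (x i))) (Pi\<^sub>E I A)
        = (\<Prod>i\<in>I. emeasure (density (M i) (f i)) (A i))" .
  qed (use \<open>finite I\<close> in \<open>auto intro!: sets_PiM_cong\<close>)
qed

text \<open>Again tested on boxes: the preimage of a box under a coordinatewise map is the box of
  the preimages.\<close>

lemma distr_PiM_componentwise:
  assumes "finite I" "\<And>i. sigma_finite_measure (M i)"
    and "\<And>i. sigma_finite_measure (distr (M i) (N i) (f i))"
    and f: "\<And>i. i \<in> I \<Longrightarrow> f i \<in> M i \<rightarrow>\<^sub>M N i"
  shows "distr (PiM I M) (PiM I N) (\<lambda>x. \<lambda>i\<in>I. f i (x i)) = PiM I (\<lambda>i. distr (M i) (N i) (f i))"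
proof -
  interpret product_sigma_finite M
    using assms by (simp add: product_sigma_finite_def)
  interpret D: product_sigma_finite "\<lambda>i. distr (M i) (N i) (f i)"
    using assms by (simp add: product_sigma_finite_def)
  show ?thesis
  proof (rule D.PiM_eqI)
    have m: "(\<lambda>x. \<lambda>i\<in>I. f i (x i)) \<in> PiM I M \<rightarrow>\<^sub>M PiM I N"
      using f by (intro measurable_restrict measurable_compose[OF measurable_component_singleton]) auto
    fix A assume A: "\<And>i. i \<in> I \<Longrightarrow> A i \<in> sets (distr (M i) (N i) (f i))"
    then have "Pi\<^sub>E I A \<in> sets (PiM I N)"
      using \<open>finite I\<close> by (auto intro!: sets_PiM_I_finite)
    then have "emeasure (distr (PiM I M) (PiM I N) (\<lambda>x. \<lambda>i\<in>I. f i (x i))) (Pi\<^sub>E I A)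
        = emeasure (PiM I M) ((\<lambda>x. \<lambda>i\<in>I. f i (x i)) -` Pi\<^sub>E I A \<inter> space (PiM I M))"
      using m by (simp add: emeasure_distr)
    also have "(\<lambda>x. \<lambda>i\<in>I. f i (x i)) -` Pi\<^sub>E I A \<inter> space (PiM I M) = Pi\<^sub>E I (\<lambda>i. f i -` A i \<inter> space (M i))"
      by (auto simp: space_PiM PiE_def Pi_def extensional_def)
    also have "emeasure (PiM I M) \<dots> = (\<Prod>i\<in>I. emeasure (M i) (f i -` A i \<inter> space (M i)))"
      using A f \<open>finite I\<close> by (intro emeasure_PiM) (auto intro: measurable_sets)
    also have "\<dots> = (\<Prod>i\<in>I. emeasure (distr (M i) (N i) (f i)) (A i))"
      using A f by (intro prod.cong refl) (simp add: emeasure_distr)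
    finally show "emeasure (distr (PiM I M) (PiM I N) (\<lambda>x. \<lambda>i\<in>I. f i (x i))) (Pi\<^sub>E I A)
        = (\<Prod>i\<in>I. emeasure (distr (M i) (N i) (f i)) (A i))" .
  qed (use \<open>finite I\<close> in \<open>auto intro!: sets_PiM_cong\<close>)
qed

section \<open>Likelihood ratio between a centred and a shifted Gaussian vector\<close>

definition gauss_PiM :: "'i set \<Rightarrow> ('i \<Rightarrow> real) \<Rightarrow> ('i \<Rightarrow> real) measure" where
  "gauss_PiM I s = (\<Pi>\<^sub>M i\<in>I. density lborel (\<lambda>x. ennreal (normal_density 0 (s i) x)))"

text \<open>The Cameron-Martin density of the Gaussian vector with mean \<open>m\<close> relative to
  the centred one, for independent coordinates with standard deviations \<open>s\<close>.\<close>

definition gauss_shift_lr :: "'i set \<Rightarrow> ('i \<Rightarrow> real) \<Rightarrow> ('i \<Rightarrow> real) \<Rightarrow> ('i \<Rightarrow> real) \<Rightarrow> real" where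
  "gauss_shift_lr I s m w = (\<Prod>i\<in>I. exp (m i * w i / (s i)\<^sup>2 - (m i)\<^sup>2 / (2 * (s i)\<^sup>2)))"

lemma sets_gauss_PiM [measurable_cong]: "sets (gauss_PiM I s) = sets (\<Pi>\<^sub>M i\<in>I. borel)"
  unfolding gauss_PiM_def by (intro sets_PiM_cong) auto

lemma normal_density_lr:
  assumes "0 < s"
  shows "normal_density 0 s x * exp (m * x / s\<^sup>2 - m\<^sup>2 / (2 * s\<^sup>2)) = normal_density m s x"
proof -
  have "normal_density 0 s x * exp (m * x / s\<^sup>2 - m\<^sup>2 / (2 * s\<^sup>2))
      = (normal_density 0 s x * exp ((m / s\<^sup>2) * x)) * exp (- m\<^sup>2 / (2 * s\<^sup>2))"
    by (simp add: exp_diff exp_minus field_simps)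
  also have "\<dots> = normal_density m s x * (exp (m\<^sup>2 / (2 * s\<^sup>2)) * exp (- m\<^sup>2 / (2 * s\<^sup>2)))"
    using exp_mult_normal_density[OF assms, of 0 x "m / s\<^sup>2"] assms by (simp add: power2_eq_square)
  also have "\<dots> = normal_density m s x"
    by (simp add: exp_add[symmetric])
  finally show ?thesis .
qed

text \<open>Both sides are the product of the normal laws with means \<open>m i\<close>: one by
  translating each coordinate, the other by reweighting it.\<close>

lemma distr_gauss_PiM_shift:
  assumes "finite I" "\<And>i. 0 < s i"
  shows "distr (gauss_PiM I s) (\<Pi>\<^sub>M i\<in>I. borel) (\<lambda>w. \<lambda>i\<in>I. w i + m i)
           = density (gauss_PiM I s) (\<lambda>w. ennreal (gauss_shift_lr I s m w))"
proof -
  let ?N = "\<lambda>a i. density lborel (\<lambda>x. ennreal (normal_density (a i) (s i) x))"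
  have sf: "sigma_finite_measure (?N a i)" for a i
    using assms by (intro prob_space_imp_sigma_finite prob_space_normal_density)
  have lr: "density (?N (\<lambda>_. 0) i) (\<lambda>x. ennreal (exp (m i * x / (s i)\<^sup>2 - (m i)\<^sup>2 / (2 * (s i)\<^sup>2)))) = ?N m i" for i
    using assms
    by (subst density_density_eq) (auto simp: ennreal_mult'[symmetric] normal_density_lr)
  have "distr (gauss_PiM I s) (\<Pi>\<^sub>M i\<in>I. borel) (\<lambda>w. \<lambda>i\<in>I. w i + m i) = PiM I (?N m)"
    unfolding gauss_PiM_def using sf assms(1)
    by (subst distr_PiM_componentwise) (simp_all add: distr_normal_density_shift)
  moreover have "density (gauss_PiM I s) (\<lambda>w. ennreal (gauss_shift_lr I s m w)) = PiM I (?N m)"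
    unfolding gauss_PiM_def gauss_shift_lr_def using sf assms(1)
    by (subst prod_ennreal[symmetric], simp, subst density_PiM) (simp_all add: lr)
  ultimately show ?thesis by simp
qed

text \<open>In each coordinate the first ratio turns the centred normal law into the one with mean
  \<open>m i\<close>; the integral of the second is then a normal moment generating function. Its
  quadratic part cancels the normalisation, so only the cross term remains.\<close>

lemma nn_integral_gauss_shift_lr_mult:
  assumes "finite I" "\<And>i. 0 < s i"
  shows "(\<integral>\<^sup>+w. ennreal (gauss_shift_lr I s m w) * ennreal (gauss_shift_lr I s m' w) \<partial>gauss_PiM I s)
           = ennreal (exp (\<Sum>i\<in>I. m i * m' i / (s i)\<^sup>2))"
proof -
  let ?N = "\<lambda>i. density lborel (\<lambda>x. ennreal (normal_density 0 (s i) x))"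
  let ?h = "\<lambda>m i x. exp (m i * x / (s i)\<^sup>2 - (m i)\<^sup>2 / (2 * (s i)\<^sup>2))"
  interpret product_sigma_finite ?N
    using assms by (auto intro!: prob_space_imp_sigma_finite prob_space_normal_density simp: product_sigma_finite_def)
  have 1: "(\<integral>\<^sup>+x. ennreal (?h m i x * ?h m' i x) \<partial>?N i) = ennreal (exp (m i * m' i / (s i)\<^sup>2))" for i
  proof -
    have s: "s i \<noteq> 0" "0 < s i" using assms(2)[of i] by auto
    have "(\<integral>\<^sup>+x. ennreal (?h m i x * ?h m' i x) \<partial>?N i)
        = (\<integral>\<^sup>+x. ennreal (normal_density 0 (s i) x) * ennreal (?h m i x * ?h m' i x) \<partial>lborel)"
      by (subst nn_integral_density) auto
    also have "\<dots> = (\<integral>\<^sup>+x. ennreal (normal_density (m i) (s i) x) *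
        ennreal (exp (m' i / (s i)\<^sup>2 * x)) * ennreal (exp (- (m' i)\<^sup>2 / (2 * (s i)\<^sup>2))) \<partial>lborel)"
    proof (intro nn_integral_cong)
      fix x
      have "normal_density 0 (s i) x * (?h m i x * ?h m' i x)
          = normal_density (m i) (s i) x * (exp (m' i / (s i)\<^sup>2 * x) * exp (- (m' i)\<^sup>2 / (2 * (s i)\<^sup>2)))"
        unfolding mult.assoc[symmetric] normal_density_lr[OF s(2)]
        unfolding mult.assoc exp_add[symmetric] by simp
      then show "ennreal (normal_density 0 (s i) x) * ennreal (?h m i x * ?h m' i x)
          = ennreal (normal_density (m i) (s i) x) * ennreal (exp (m' i / (s i)\<^sup>2 * x)) * ennreal (exp (- (m' i)\<^sup>2 / (2 * (s i)\<^sup>2)))"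
        by (simp only: ennreal_mult[symmetric] mult.assoc exp_ge_zero mult_nonneg_nonneg normal_density_nonneg)
    qed
    also have "\<dots> = ennreal (exp (m i * (m' i / (s i)\<^sup>2) + (m' i / (s i)\<^sup>2)\<^sup>2 * (s i)\<^sup>2 / 2)) * ennreal (exp (- (m' i)\<^sup>2 / (2 * (s i)\<^sup>2)))"
      by (subst nn_integral_multc) (simp_all only: nn_integral_exp_normal_density[OF s(2)], measurable)
    also have "\<dots> = ennreal (exp (m i * m' i / (s i)\<^sup>2))"
      using s by (simp add: ennreal_mult'[symmetric] exp_add[symmetric] power2_eq_square)
    finally show ?thesis .
  qed
  have "(\<integral>\<^sup>+w. ennreal (gauss_shift_lr I s m w) * ennreal (gauss_shift_lr I s m' w) \<partial>gauss_PiM I s)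
      = (\<integral>\<^sup>+w. (\<Prod>i\<in>I. ennreal (?h m i (w i) * ?h m' i (w i))) \<partial>gauss_PiM I s)"
    unfolding gauss_shift_lr_def
    by (simp add: prod_ennreal ennreal_mult[symmetric] prod_nonneg prod.distrib)
  also have "\<dots> = (\<Prod>i\<in>I. \<integral>\<^sup>+x. ennreal (?h m i x * ?h m' i x) \<partial>?N i)"
    unfolding gauss_PiM_def using assms(1) by (intro product_nn_integral_prod) auto
  also have "\<dots> = ennreal (exp (\<Sum>i\<in>I. m i * m' i / (s i)\<^sup>2))"
    unfolding 1 using assms(1) by (simp add: prod_ennreal exp_sum)
  finally show ?thesis .
qed

subsection \<open>Gaussian location mixtures\<close>

text \<open>
  The observation $T (W + m(x))$ of signal plus noise determines its argument: $S$ is a left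
  inverse of $T$. For the Wigner model, $T$ symmetrises and rescales the upper triangle.
\<close>

locale gauss_mixture = prob_space X for X :: "'a measure" +
  fixes I :: "'i set" and s :: "'i \<Rightarrow> real" and m :: "'a \<Rightarrow> 'i \<Rightarrow> real"
    and N :: "'b measure" and T :: "('i \<Rightarrow> real) \<Rightarrow> 'b" and S :: "'b \<Rightarrow> 'i \<Rightarrow> real"
  assumes finite_index: "finite I" and sd_pos: "0 < s i"
    and mean_measurable [measurable]: "i \<in> I \<Longrightarrow> (\<lambda>x. m x i) \<in> borel_measurable X"
    and T_measurable [measurable]: "T \<in> (\<Pi>\<^sub>M i\<in>I. borel) \<rightarrow>\<^sub>M N"
    and S_measurable [measurable]: "S \<in> N \<rightarrow>\<^sub>M (\<Pi>\<^sub>M i\<in>I. borel)"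
    and S_T: "w \<in> space (\<Pi>\<^sub>M i\<in>I. (borel :: real measure)) \<Longrightarrow> S (T w) = w"
begin

abbreviation "G \<equiv> gauss_PiM I s"

definition signal_law :: "'b measure" where
  "signal_law = distr (X \<Otimes>\<^sub>M G) N (\<lambda>(x, w). T (\<lambda>i\<in>I. w i + m x i))"

definition null_law :: "'b measure" where
  "null_law = distr G N T"

text \<open>Composing with \<open>S\<close> makes the averaged ratio a function of the observation.
  Values in \<open>ennreal\<close> let Tonelli apply before any integrability is known.\<close>

definition mixture_lr :: "'b \<Rightarrow> ennreal" where
  "mixture_lr Y = (\<integral>\<^sup>+x. ennreal (gauss_shift_lr I s (m x) (S Y)) \<partial>X)"

section \<open>Measurability in the mixture model\<close>

lemma prob_space_G: "prob_space G"
  unfolding gauss_PiM_def using sd_pos by (intro prob_space_PiM prob_space_normal_density)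

sublocale XG: pair_sigma_finite X G
  by (intro pair_sigma_finite.intro sigma_finite_measure_axioms prob_space_imp_sigma_finite[OF prob_space_G])

lemma component_measurable_G [measurable]: "i \<in> I \<Longrightarrow> (\<lambda>w. w i) \<in> borel_measurable G"
  by (simp add: measurable_cong_sets[OF sets_gauss_PiM refl])

lemma T_measurable_G [measurable]: "T \<in> G \<rightarrow>\<^sub>M N"
  by (simp add: measurable_cong_sets[OF sets_gauss_PiM refl])

lemma gauss_shift_lr_measurable [measurable]:
  assumes [measurable]: "\<And>i. i \<in> I \<Longrightarrow> (\<lambda>p. f p i) \<in> borel_measurable M"
    and [measurable]: "\<And>i. i \<in> I \<Longrightarrow> (\<lambda>p. g p i) \<in> borel_measurable M"
  shows "(\<lambda>p. gauss_shift_lr I s (f p) (g p)) \<in> borel_measurable M"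
  unfolding gauss_shift_lr_def by measurable

lemma S_component_measurable [measurable]: "i \<in> I \<Longrightarrow> (\<lambda>Y. S Y i) \<in> borel_measurable N"
  using measurable_compose[OF S_measurable measurable_component_singleton] by simp

lemma mean_measurable_fst [measurable]: "i \<in> I \<Longrightarrow> (\<lambda>p. m (fst p) i) \<in> borel_measurable (X \<Otimes>\<^sub>M M)"
  using measurable_compose[OF measurable_fst mean_measurable] by simp

lemma mean_measurable_snd [measurable]: "i \<in> I \<Longrightarrow> (\<lambda>p. m (snd p) i) \<in> borel_measurable (M \<Otimes>\<^sub>M X)"
  using measurable_compose[OF measurable_snd mean_measurable] by simp

lemma G_component_measurable_snd [measurable]:
  "i \<in> I \<Longrightarrow> (\<lambda>p. snd p i) \<in> borel_measurable (M \<Otimes>\<^sub>M G)"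
  using measurable_compose[OF measurable_snd component_measurable_G] by simp

lemma lr_obs_measurable [measurable]:
  "(\<lambda>p. gauss_shift_lr I s (m (snd p)) (S (fst p))) \<in> borel_measurable (N \<Otimes>\<^sub>M X)"
  using measurable_compose[OF measurable_fst S_component_measurable] by (intro gauss_shift_lr_measurable) auto

lemma mixture_lr_measurable [measurable]: "mixture_lr \<in> borel_measurable N"
  unfolding mixture_lr_def using lr_obs_measurable
  by (intro borel_measurable_nn_integral) (simp add: split_beta')

lemma signal_measurable [measurable]: "(\<lambda>p. T (\<lambda>i\<in>I. snd p i + m (fst p) i)) \<in> X \<Otimes>\<^sub>M G \<rightarrow>\<^sub>M N"
  by (rule measurable_compose[OF _ T_measurable]) (intro measurable_restrict borel_measurable_add; measurable)

lemma mixture_lr_T: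
  "w \<in> space G \<Longrightarrow> mixture_lr (T w) = (\<integral>\<^sup>+x. ennreal (gauss_shift_lr I s (m x) w) \<partial>X)"
  by (simp add: mixture_lr_def S_T sets_eq_imp_space_eq[OF sets_gauss_PiM])

text \<open>For fixed \<open>x\<close> the signal only translates the noise, so the shift density
  with respect to \<open>G\<close> describes it; Tonelli then moves the average over
  \<open>x\<close> inside the noise integral.\<close>

lemma signal_law_eq_density: "signal_law = density null_law mixture_lr"
proof (rule measure_eqI)
  fix A assume "A \<in> sets signal_law"
  then have A [measurable]: "A \<in> sets N" by (simp add: signal_law_def)
  have [measurable]: "(\<lambda>p. indicator A (T (snd p)) :: ennreal) \<in> borel_measurable (X \<Otimes>\<^sub>M G)"
    by measurable
  have "emeasure signal_law A = (\<integral>\<^sup>+Y. indicator A Y \<partial>signal_law)"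
    by (simp add: signal_law_def)
  also have "\<dots> = (\<integral>\<^sup>+p. indicator A (T (\<lambda>i\<in>I. snd p i + m (fst p) i)) \<partial>(X \<Otimes>\<^sub>M G))"
    unfolding signal_law_def split_beta' by (rule nn_integral_distr) measurable
  also have "\<dots> = (\<integral>\<^sup>+x. \<integral>\<^sup>+w. indicator A (T (\<lambda>i\<in>I. w i + m x i)) \<partial>G \<partial>X)"
    by (subst XG.M2.nn_integral_fst[symmetric]) auto
  also have "\<dots> = (\<integral>\<^sup>+x. \<integral>\<^sup>+w. ennreal (gauss_shift_lr I s (m x) w) * indicator A (T w) \<partial>G \<partial>X)"
  proof (rule nn_integral_cong)
    fix x
    have "(\<integral>\<^sup>+w. indicator A (T (\<lambda>i\<in>I. w i + m x i)) \<partial>G)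
        = (\<integral>\<^sup>+w. indicator A (T w) \<partial>distr G (\<Pi>\<^sub>M i\<in>I. borel) (\<lambda>w. \<lambda>i\<in>I. w i + m x i))"
      by (intro nn_integral_distr[symmetric] measurable_restrict) measurable
    also have "\<dots> = (\<integral>\<^sup>+w. ennreal (gauss_shift_lr I s (m x) w) * indicator A (T w) \<partial>G)"
      unfolding distr_gauss_PiM_shift[OF finite_index sd_pos]
      by (intro nn_integral_density) measurable
    finally show "(\<integral>\<^sup>+w. indicator A (T (\<lambda>i\<in>I. w i + m x i)) \<partial>G)
      = (\<integral>\<^sup>+w. ennreal (gauss_shift_lr I s (m x) w) * indicator A (T w) \<partial>G)" .
  qed
  also have "\<dots> = (\<integral>\<^sup>+w. \<integral>\<^sup>+x. ennreal (gauss_shift_lr I s (m x) w) * indicator A (T w) \<partial>X \<partial>G)"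
    by (rule XG.Fubini'[symmetric]) (simp add: split_beta')
  also have "\<dots> = (\<integral>\<^sup>+w. mixture_lr (T w) * indicator A (T w) \<partial>G)"
    by (intro nn_integral_cong) (simp add: mixture_lr_T nn_integral_multc)
  also have "\<dots> = (\<integral>\<^sup>+Y. mixture_lr Y * indicator A Y \<partial>null_law)"
    unfolding null_law_def by (rule nn_integral_distr[symmetric]) measurable
  also have "\<dots> = emeasure (density null_law mixture_lr) A"
    by (simp add: emeasure_density null_law_def)
  finally show "emeasure signal_law A = emeasure (density null_law mixture_lr) A" .
qed (simp add: signal_law_def null_law_def)

lemma prob_space_null_law: "prob_space null_law"
  unfolding null_law_def by (intro prob_space.prob_space_distr prob_space_G) measurable

lemma absolutely_continuous_signal_law: "absolutely_continuous null_law signal_law"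
  unfolding signal_law_eq_density
  by (rule absolutely_continuousI_density) (simp add: null_law_def)

text \<open>The square of an average over \<open>x\<close> is a double average over independent
  copies \<open>x\<close> and \<open>x'\<close>. Two Tonelli exchanges, one per copy, bring the
  noise integral innermost, where it acts on a product of two shift densities.\<close>

lemma second_moment_signal_law:
  "lr_second_moment signal_law null_law
     = (\<integral>\<^sup>+x. \<integral>\<^sup>+x'. ennreal (exp (\<Sum>i\<in>I. m x i * m x' i / (s i)\<^sup>2)) \<partial>X \<partial>X)"
proof -
  let ?L = "\<lambda>x w. ennreal (gauss_shift_lr I s (m x) w)"
  interpret Q: prob_space null_law by (rule prob_space_null_law)
  \<comment> \<open>\<open>RN_deriv\<close> is determined only almost everywhere under the null law,
    which suffices under the integral.\<close>
  have "AE Y in null_law. mixture_lr Y = RN_deriv null_law signal_law Y"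
    by (rule Q.RN_deriv_unique) (simp_all add: signal_law_eq_density null_law_def)
  then have "lr_second_moment signal_law null_law = (\<integral>\<^sup>+Y. (mixture_lr Y)\<^sup>2 \<partial>null_law)"
    unfolding lr_second_moment_def by (intro nn_integral_cong_AE) auto
  also have "\<dots> = (\<integral>\<^sup>+w. (mixture_lr (T w))\<^sup>2 \<partial>G)"
    unfolding null_law_def by (rule nn_integral_distr) measurable
  also have "\<dots> = (\<integral>\<^sup>+w. \<integral>\<^sup>+x. \<integral>\<^sup>+x'. ?L x w * ?L x' w \<partial>X \<partial>X \<partial>G)"
  proof (rule nn_integral_cong)
    fix w assume w: "w \<in> space G"
    have "(\<lambda>x. ?L x w) \<in> borel_measurable X" by measurable
    then show "(mixture_lr (T w))\<^sup>2 = (\<integral>\<^sup>+x. \<integral>\<^sup>+x'. ?L x w * ?L x' w \<partial>X \<partial>X)"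
      using w by (simp add: mixture_lr_T power2_eq_square nn_integral_cmult nn_integral_multc)
  qed
  also have "\<dots> = (\<integral>\<^sup>+x. \<integral>\<^sup>+w. \<integral>\<^sup>+x'. ?L x w * ?L x' w \<partial>X \<partial>G \<partial>X)"
  proof (rule XG.Fubini')
    let ?M = "(X \<Otimes>\<^sub>M G) \<Otimes>\<^sub>M X"
    have [measurable]: "(\<lambda>q. m (fst (fst q)) i) \<in> borel_measurable ?M"
        "(\<lambda>q. m (snd q) i) \<in> borel_measurable ?M"
        "(\<lambda>q. snd (fst q) i) \<in> borel_measurable ?M" if "i \<in> I" for i
      using that measurable_compose[OF measurable_fst mean_measurable_fst[OF that]]
        measurable_compose[OF measurable_fst G_component_measurable_snd[OF that]] by simp_all
    have *: "(\<lambda>q. ?L (fst (fst q)) (snd (fst q)) * ?L (snd q) (snd (fst q))) \<in> borel_measurable ?M"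
      by measurable
    show "(\<lambda>(x, w). \<integral>\<^sup>+x'. ?L x w * ?L x' w \<partial>X) \<in> borel_measurable (X \<Otimes>\<^sub>M G)"
      using * unfolding split_beta' by (intro borel_measurable_nn_integral) (simp add: split_beta')
  qed
  also have "\<dots> = (\<integral>\<^sup>+x. \<integral>\<^sup>+x'. \<integral>\<^sup>+w. ?L x w * ?L x' w \<partial>G \<partial>X \<partial>X)"
  proof (intro nn_integral_cong XG.Fubini')
    fix x
    have "(\<lambda>p. gauss_shift_lr I s (m x) (snd p)) \<in> borel_measurable (X \<Otimes>\<^sub>M G)"
      by measurable
    then show "(\<lambda>(x', w). ?L x w * ?L x' w) \<in> borel_measurable (X \<Otimes>\<^sub>M G)"
      by (simp add: split_beta')
  qed
  also have "\<dots> = (\<integral>\<^sup>+x. \<integral>\<^sup>+x'. ennreal (exp (\<Sum>i\<in>I. m x i * m x' i / (s i)\<^sup>2)) \<partial>X \<partial>X)"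
    unfolding nn_integral_gauss_shift_lr_mult[OF finite_index sd_pos] ..
  finally show ?thesis .
qed

end

subsection \<open>Powers of moment generating functions\<close>

text \<open>Write \<open>b n = 1 + a n / n\<close> with \<open>a\<close> converging to
  \<open>L\<close>; then \<open>n * ln (b n) - a n\<close> is of order \<open>(a n)^2 / n\<close>
  and vanishes in the limit.\<close>

lemma power_tendsto_exp:
  fixes b :: "nat \<Rightarrow> real"
  assumes "(\<lambda>n. real n * (b n - 1)) \<longlonglongrightarrow> L"
  shows "(\<lambda>n. b n ^ n) \<longlonglongrightarrow> exp L"
proof -
  define a where "a n = real n * (b n - 1)" for n
  have a: "a \<longlonglongrightarrow> L" using assms by (simp add: a_def[abs_def])
  have x0: "(\<lambda>n. a n / real n) \<longlonglongrightarrow> 0"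
    using tendsto_mult[OF a lim_inverse_n] by (simp add: divide_inverse)
  have b: "b n = 1 + a n / real n" if "n > 0" for n
    using that by (simp add: a_def)
  \<comment> \<open>The bound 1/2 admits the quadratic estimate of the logarithm and also keeps
    \<open>b n\<close> positive.\<close>
  have small: "\<forall>\<^sub>F n in sequentially. \<bar>a n / real n\<bar> \<le> 1 / 2"
    using order_tendstoD(2)[OF tendsto_rabs[OF x0], of "1 / 2"] by (auto elim: eventually_mono)
  have "(\<lambda>n. real n * ln (b n) - a n) \<longlonglongrightarrow> 0"
  proof (rule Lim_null_comparison)
    show "\<forall>\<^sub>F n in sequentially. norm (real n * ln (b n) - a n) \<le> 2 * a n * (a n / real n)"
      using small eventually_gt_at_top[of 0]
    proof eventually_elim
      case (elim n)
      have "\<bar>ln (1 + a n / real n) - a n / real n\<bar> \<le> 2 * (a n / real n)\<^sup>2"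
        using elim by (intro abs_ln_one_plus_x_minus_x_bound) auto
      then have "real n * \<bar>ln (b n) - a n / real n\<bar> \<le> real n * (2 * (a n / real n)\<^sup>2)"
        using elim by (intro mult_left_mono) (simp_all add: b)
      moreover have "real n * \<bar>ln (b n) - a n / real n\<bar> = \<bar>real n * ln (b n) - a n\<bar>"
        using elim by (subst abs_of_nat[symmetric], subst abs_mult[symmetric]) (simp add: algebra_simps)
      moreover have "real n * (2 * (a n / real n)\<^sup>2) = 2 * a n * (a n / real n)"
        using elim by (simp add: power2_eq_square)
      ultimately show ?case by simp
    qed
    show "(\<lambda>n. 2 * a n * (a n / real n)) \<longlonglongrightarrow> 0"
      using tendsto_mult[OF tendsto_mult[OF tendsto_const[of 2] a] x0] by simp
  qed
  from tendsto_add[OF this a] have "(\<lambda>n. exp (real n * ln (b n))) \<longlonglongrightarrow> exp L"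
    by (intro tendsto_exp) simp
  moreover have "\<forall>\<^sub>F n in sequentially. exp (real n * ln (b n)) = b n ^ n"
    using small eventually_gt_at_top[of 0]
  proof eventually_elim
    case (elim n)
    then have "0 < 1 + a n / real n" by linarith
    then have "b n > 0" using elim by (simp add: b)
    then show ?case by (simp add: exp_of_nat_mult)
  qed
  ultimately show ?thesis
    by (rule Lim_transform_eventually)
qed

text \<open>Taylor expansion with Lagrange remainder; it serves to dominate the rescaled remainder
  uniformly in \<open>n\<close>.\<close>

lemma exp_second_order_bound:
  fixes y :: real
  shows "\<bar>exp y - 1 - y\<bar> \<le> y\<^sup>2 * exp \<bar>y\<bar>"
proof -
  obtain t where t: "\<bar>t\<bar> \<le> \<bar>y\<bar>" "exp y = (\<Sum>m<2. y ^ m / fact m) + exp t / fact 2 * y ^ 2"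
    using Maclaurin_exp_le[of y 2] by blast
  then have "\<bar>exp y - 1 - y\<bar> = exp t / 2 * y\<^sup>2"
    by (simp add: numeral_2_eq_2 abs_mult)
  also have "\<dots> \<le> exp \<bar>y\<bar> * y\<^sup>2"
  proof (rule mult_right_mono)
    have "exp t \<le> exp \<bar>y\<bar>" using t(1) by simp
    then show "exp t / 2 \<le> exp \<bar>y\<bar>"
      using exp_gt_zero[of t] by linarith
  qed simp
  finally show ?thesis by (simp add: mult.commute)
qed

text \<open>The asymptotic expansion is computed for a fixed sign of \<open>z\<close>; at zero every
  term vanishes.\<close>

lemma exp_second_order_tendsto:
  fixes z :: real
  shows "(\<lambda>n. real n * (exp (z / sqrt (real n)) - 1 - z / sqrt (real n))) \<longlonglongrightarrow> z\<^sup>2 / 2"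
proof (cases z "0 :: real" rule: linorder_cases)
  case less
  then have "(\<lambda>n. real n * (exp (z / sqrt (real n)) - 1 - z / sqrt (real n))) \<longlonglongrightarrow> z * z / 2"
    by real_asymp
  then show ?thesis by (simp add: power2_eq_square)
next
  case greater
  then have "(\<lambda>n. real n * (exp (z / sqrt (real n)) - 1 - z / sqrt (real n))) \<longlonglongrightarrow> z * z / 2"
    by real_asymp
  then show ?thesis by (simp add: power2_eq_square)
qed simp

text \<open>Trades a quadratic factor for an exponential one, so that finite exponential moments
  control second-order terms.\<close>

lemma power2_le_exp_abs: "(x :: real)\<^sup>2 \<le> 2 * exp \<bar>x\<bar>"
proof -
  have "\<bar>x\<bar>\<^sup>2 / 2 \<le> exp \<bar>x\<bar>"
    using exp_lower_Taylor_quadratic[of "\<bar>x\<bar>"] by simp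
  then show ?thesis by simp
qed

text \<open>A central limit statement at the level of moment generating functions. Mean zero removes
  the first-order term of the expansion, unit variance fixes the second, and dominated convergence
  carries the pointwise expansion through the expectation.\<close>

lemma (in prob_space) mgf_power_tendsto:
  fixes Z :: "'a \<Rightarrow> real"
  assumes Z: "Z \<in> borel_measurable M" "integrable M Z" "expectation Z = 0"
    and var: "expectation (\<lambda>x. (Z x)\<^sup>2) = 1"
    and mgf: "\<And>t. integrable M (\<lambda>x. exp (t * Z x))"
  shows "(\<lambda>n. expectation (\<lambda>x. exp (t / sqrt (real n) * Z x)) ^ n) \<longlonglongrightarrow> exp (t\<^sup>2 / 2)"
proof (rule power_tendsto_exp)
  note [measurable] = Z(1)
  \<comment> \<open>Since \<open>Z\<close> has mean zero, its linear term can be subtracted under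
    the expectation.\<close>
  have eq: "real n * (expectation (\<lambda>x. exp (t / sqrt (real n) * Z x)) - 1)
      = expectation (\<lambda>x. real n * (exp (t * Z x / sqrt (real n)) - 1 - t * Z x / sqrt (real n)))" for n
    using mgf[of "t / sqrt (real n)"] Z(2,3) by (simp add: prob_space)
  have "(\<lambda>n. expectation (\<lambda>x. real n * (exp (t * Z x / sqrt (real n)) - 1 - t * Z x / sqrt (real n))))
      \<longlonglongrightarrow> expectation (\<lambda>x. (t * Z x)\<^sup>2 / 2)"
  proof (rule integral_dominated_convergence)
    show "integrable M (\<lambda>x. 2 * exp (2 * \<bar>t * Z x\<bar>))"
    proof (rule Bochner_Integration.integrable_bound)
      show "integrable M (\<lambda>x. 2 * (exp ((2 * t) * Z x) + exp ((- 2 * t) * Z x)))"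
        using mgf[of "2 * t"] mgf[of "- 2 * t"] by simp
      \<comment> \<open>One of the two exponentials on the right already equals the one on the left,
        and both are integrable by \<open>mgf\<close>.\<close>
      have "2 * exp (2 * \<bar>y\<bar>) \<le> 2 * exp (2 * y) + 2 * exp (- (2 * y))" for y :: real
        by (cases "y \<ge> 0") (simp_all add: abs_if)
      from this[of "t * Z x" for x]
      show "AE x in M. norm (2 * exp (2 * \<bar>t * Z x\<bar>)) \<le> norm (2 * (exp ((2 * t) * Z x) + exp ((- 2 * t) * Z x)))"
        by (intro AE_I2) (simp add: abs_of_nonneg add_nonneg_nonneg mult.assoc)
    qed measurable
    show "AE x in M. norm (real n * (exp (t * Z x / sqrt (real n)) - 1 - t * Z x / sqrt (real n)))
        \<le> 2 * exp (2 * \<bar>t * Z x\<bar>)" for n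
    proof (intro AE_I2)
      fix x
      let ?y = "t * Z x"
      show "norm (real n * (exp (?y / sqrt (real n)) - 1 - ?y / sqrt (real n))) \<le> 2 * exp (2 * \<bar>?y\<bar>)"
      \<comment> \<open>For \<open>n = 0\<close> the factor \<open>real n\<close> makes the term
        vanish. Otherwise \<open>n\<close> cancels the squared \<open>sqrt n\<close> in the
        remainder, and \<open>sqrt n\<close> is at least 1 in the exponent.\<close>
      proof (cases "n = 0")
        case False
        have "norm (real n * (exp (?y / sqrt (real n)) - 1 - ?y / sqrt (real n)))
            \<le> real n * ((?y / sqrt (real n))\<^sup>2 * exp \<bar>?y / sqrt (real n)\<bar>)"
          unfolding real_norm_def abs_mult by (intro mult_mono exp_second_order_bound) auto
        also have "\<dots> = ?y\<^sup>2 * exp \<bar>?y / sqrt (real n)\<bar>"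
          using False by (simp add: power_divide)
        also have "\<dots> \<le> (2 * exp \<bar>?y\<bar>) * exp \<bar>?y\<bar>"
        proof (rule mult_mono)
          have "\<bar>?y\<bar> / sqrt (real n) \<le> \<bar>?y\<bar> / 1"
            using False by (intro divide_left_mono) auto
          then show "exp \<bar>?y / sqrt (real n)\<bar> \<le> exp \<bar>?y\<bar>" by simp
        qed (rule power2_le_exp_abs, auto)
        also have "\<dots> = 2 * exp (2 * \<bar>?y\<bar>)"
          by (simp add: mult.assoc exp_add[symmetric])
        finally show ?thesis .
      qed simp
    qed
    show "AE x in M. (\<lambda>n. real n * (exp (t * Z x / sqrt (real n)) - 1 - t * Z x / sqrt (real n)))
        \<longlonglongrightarrow> (t * Z x)\<^sup>2 / 2"
      by (intro AE_I2 exp_second_order_tendsto)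
  qed measurable
  also have "expectation (\<lambda>x. (t * Z x)\<^sup>2 / 2) = t\<^sup>2 / 2"
    using var by (simp add: power_mult_distrib)
  finally show "(\<lambda>n. real n * (expectation (\<lambda>x. exp (t / sqrt (real n) * Z x)) - 1)) \<longlonglongrightarrow> t\<^sup>2 / 2"
    unfolding eq .
qed

text \<open>The integrand is a multiple of the centred normal density of variance
  \<open>1 / (1 - a)\<close>, which is positive because \<open>a < 1\<close>.\<close>

lemma nn_integral_exp_square_normal_density:
  assumes "a < 1"
  shows "(\<integral>\<^sup>+g. ennreal (std_normal_density g) * ennreal (exp (a * g\<^sup>2 / 2)) \<partial>lborel) = ennreal (1 / sqrt (1 - a))"
proof -
  have "std_normal_density g * exp (a * g\<^sup>2 / 2) = 1 / sqrt (1 - a) * normal_density 0 (1 / sqrt (1 - a)) g" for g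
  proof -
    have "- g\<^sup>2 / 2 + a * g\<^sup>2 / 2 = - ((1 - a) * g\<^sup>2) / 2"
      by (simp add: field_simps)
    then have "exp (- g\<^sup>2 / 2) * exp (a * g\<^sup>2 / 2) = exp (- ((1 - a) * g\<^sup>2) / 2)"
      by (simp only: exp_add[symmetric])
    then show ?thesis
      using assms by (simp add: normal_density_def power_divide real_sqrt_divide mult.commute)
  qed
  then have "(\<integral>\<^sup>+g. ennreal (std_normal_density g) * ennreal (exp (a * g\<^sup>2 / 2)) \<partial>lborel)
      = (\<integral>\<^sup>+g. ennreal (1 / sqrt (1 - a)) * ennreal (normal_density 0 (1 / sqrt (1 - a)) g) \<partial>lborel)"
    using assms by (intro nn_integral_cong) (simp only: ennreal_mult[symmetric] normal_density_nonneg exp_ge_zero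
      zero_le_divide_1_iff real_sqrt_ge_zero diff_ge_0_iff_ge less_imp_le)
  also have "\<dots> = ennreal (1 / sqrt (1 - a)) * (\<integral>\<^sup>+g. ennreal (normal_density 0 (1 / sqrt (1 - a)) g) \<partial>lborel)"
    by (rule nn_integral_cmult) simp
  also have "(\<integral>\<^sup>+g. ennreal (normal_density 0 (1 / sqrt (1 - a)) g) \<partial>lborel) = 1"
    using assms by (intro nn_integral_normal_density) simp
  finally show ?thesis by simp
qed

text \<open>The bound on \<open>F\<close> is the exponential of a quadratic, so the
  \<open>n\<close>-th power undoes the division by \<open>sqrt n\<close>. This gives a majorant free
  of \<open>n\<close>, integrable against the Gaussian since
  \<open>l\<^sup>2 * v < 1\<close>.\<close>

lemma nn_integral_mgf_power_tendsto:
  fixes F :: "real \<Rightarrow> real"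
  assumes [measurable]: "F \<in> borel_measurable borel"
    and F0: "\<And>t. 0 \<le> F t" and sub: "\<And>t. F t \<le> exp (v * t\<^sup>2 / 2)"
    and lim: "\<And>t. (\<lambda>n. F (t / sqrt (real n)) ^ n) \<longlonglongrightarrow> exp (t\<^sup>2 / 2)"
    and l: "l\<^sup>2 * v < 1" "l\<^sup>2 < 1" "0 \<le> v"
  shows "(\<lambda>n. \<integral>\<^sup>+g. ennreal (std_normal_density g) * ennreal (F (l * g / sqrt (real n)) ^ n) \<partial>lborel)
           \<longlonglongrightarrow> ennreal (1 / sqrt (1 - l\<^sup>2))"
proof -
  have "(\<lambda>n. \<integral>\<^sup>+g. ennreal (std_normal_density g) * ennreal (F (l * g / sqrt (real n)) ^ n) \<partial>lborel)
      \<longlonglongrightarrow> (\<integral>\<^sup>+g. ennreal (std_normal_density g) * ennreal (exp (l\<^sup>2 * g\<^sup>2 / 2)) \<partial>lborel)"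
  proof (rule nn_integral_dominated_convergence)
    show "AE g in lborel. ennreal (std_normal_density g) * ennreal (F (l * g / sqrt (real n)) ^ n)
        \<le> ennreal (std_normal_density g) * ennreal (exp ((l\<^sup>2 * v) * g\<^sup>2 / 2))" for n
    proof (intro AE_I2 mult_left_mono ennreal_leI)
      fix g
      have "F (l * g / sqrt (real n)) ^ n \<le> exp (v * (l * g / sqrt (real n))\<^sup>2 / 2) ^ n"
        by (intro power_mono sub F0)
      also have "\<dots> = exp (real n * (v * (l * g / sqrt (real n))\<^sup>2 / 2))"
        by (rule exp_of_nat_mult[symmetric])
      \<comment> \<open>For positive \<open>n\<close> this is an equality. At \<open>n = 0\<close>
        the left side is 1, and \<open>0 \<le> v\<close> gives the bound.\<close>
      also have "\<dots> \<le> exp ((l\<^sup>2 * v) * g\<^sup>2 / 2)"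
        using l(3) by (cases "n = 0") (simp_all add: power_mult_distrib power_divide)
      finally show "F (l * g / sqrt (real n)) ^ n \<le> exp ((l\<^sup>2 * v) * g\<^sup>2 / 2)" .
    qed simp
    show "(\<integral>\<^sup>+g. ennreal (std_normal_density g) * ennreal (exp ((l\<^sup>2 * v) * g\<^sup>2 / 2)) \<partial>lborel) < \<infinity>"
      by (simp only: nn_integral_exp_square_normal_density[OF l(1)] ennreal_less_top infinity_ennreal_def)
    show "AE g in lborel. (\<lambda>n. ennreal (std_normal_density g) * ennreal (F (l * g / sqrt (real n)) ^ n))
        \<longlonglongrightarrow> ennreal (std_normal_density g) * ennreal (exp (l\<^sup>2 * g\<^sup>2 / 2))"
    proof (intro AE_I2)
      fix g
      have "(\<lambda>n. std_normal_density g * F (l * g / sqrt (real n)) ^ n)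
          \<longlonglongrightarrow> std_normal_density g * exp (l\<^sup>2 * g\<^sup>2 / 2)"
        using lim[of "l * g"] by (intro tendsto_intros) (simp add: power_mult_distrib)
      then show "(\<lambda>n. ennreal (std_normal_density g) * ennreal (F (l * g / sqrt (real n)) ^ n))
          \<longlonglongrightarrow> ennreal (std_normal_density g) * ennreal (exp (l\<^sup>2 * g\<^sup>2 / 2))"
        using F0 by (simp add: ennreal_mult'[symmetric] tendsto_ennrealI)
    qed
  qed measurable
  then show ?thesis
    by (simp only: nn_integral_exp_square_normal_density[OF l(2)])
qed

subsection \<open>Overlaps under product priors\<close>

lemma finite_upper_index: "finite (upper_index n)"
  by (rule finite_subset[of _ "{..<n} \<times> {..<n}"]) (auto simp: upper_index_def)

abbreviation goe_sd :: "nat \<times> nat \<Rightarrow> real" where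
  "goe_sd ij \<equiv> (if fst ij = snd ij then sqrt 2 else 1)"

text \<open>The square of the sum counts each off-diagonal pair twice and each diagonal entry once;
  halving leaves the weights 1 and 1/2, the inverse variances of the GOE. The induction adds the
  last column.\<close>

lemma sum_upper_index_mult:
  fixes f :: "nat \<Rightarrow> real"
  shows "(\<Sum>ij\<in>upper_index n. f (fst ij) * f (snd ij) / (goe_sd ij)\<^sup>2) = (\<Sum>i<n. f i)\<^sup>2 / 2"
proof (induction n)
  case 0
  then show ?case by (simp add: upper_index_def)
next
  case (Suc n)
  let ?g = "\<lambda>ij. f (fst ij) * f (snd ij) / (goe_sd ij)\<^sup>2"
  have "upper_index (Suc n) = upper_index n \<union> (\<lambda>i. (i, n)) ` {..n}"
    by (auto simp: upper_index_def less_Suc_eq)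
  moreover have "upper_index n \<inter> (\<lambda>i. (i, n)) ` {..n} = {}"
    by (auto simp: upper_index_def)
  ultimately have "sum ?g (upper_index (Suc n)) = sum ?g (upper_index n) + sum ?g ((\<lambda>i. (i, n)) ` {..n})"
    by (simp add: sum.union_disjoint finite_upper_index)
  also have "sum ?g ((\<lambda>i. (i, n)) ` {..n}) = (\<Sum>i\<le>n. ?g (i, n))"
    by (subst sum.reindex) (auto simp: inj_on_def)
  also have "{..n} = insert n {..<n}" by auto
  also have "(\<Sum>i\<in>insert n {..<n}. ?g (i, n)) = (f n)\<^sup>2 / 2 + (\<Sum>i<n. f i * f n)"
    by (simp add: power2_eq_square)
  also have "(\<Sum>i<n. f i * f n) = (\<Sum>i<n. f i) * f n"
    by (simp add: sum_distrib_right)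
  finally show ?case
    using Suc by (simp add: power2_eq_square algebra_simps)
qed

text \<open>Hubbard-Stratonovich linearisation: \<open>exp (a^2 / 2)\<close> is the mean of
  \<open>exp (a * g)\<close> for a standard normal \<open>g\<close>. For fixed \<open>g\<close> the
  exponent is a sum over coordinates, so the integral over both copies becomes an
  \<open>n\<close>-th power.\<close>

lemma nn_integral_exp_overlap_square:
  fixes \<nu> :: "real measure" and n :: nat
  assumes "prob_space \<nu>" and [measurable_cong]: "sets \<nu> = sets borel"
  defines "X \<equiv> \<Pi>\<^sub>M i\<in>{..<n}. \<nu>"
  shows "(\<integral>\<^sup>+x. \<integral>\<^sup>+x'. ennreal (exp ((c * (\<Sum>i<n. x i * x' i))\<^sup>2 / 2)) \<partial>X \<partial>X)
    = (\<integral>\<^sup>+g. ennreal (std_normal_density g) * (\<integral>\<^sup>+u. \<integral>\<^sup>+u'. ennreal (exp (c * g * (u * u'))) \<partial>\<nu> \<partial>\<nu>) ^ n \<partial>lborel)"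
proof -
  interpret \<nu>: prob_space \<nu> by fact
  interpret product_sigma_finite "\<lambda>_::nat. \<nu>"
    by (simp add: product_sigma_finite_def \<nu>.sigma_finite_measure_axioms)
  interpret X: prob_space X
    unfolding X_def by (intro prob_space_PiM assms)
  interpret LX: pair_sigma_finite X lborel
    by (intro pair_sigma_finite.intro X.sigma_finite_measure_axioms lborel.sigma_finite_measure_axioms)
  let ?S = "\<lambda>x x'. \<Sum>i<n. x i * x' i"
  let ?\<phi> = "\<lambda>g. ennreal (std_normal_density g)"
  have exp_measurable: "(\<lambda>u. ennreal (exp (c * g * (a * u)))) \<in> borel_measurable \<nu>" for a g
    by measurable
  have comp [measurable]: "(\<lambda>x. x i) \<in> borel_measurable X" if "i < n" for i
    using that measurable_component_singleton[of i "{..<n}" "\<lambda>_. \<nu>"]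
    by (simp add: X_def measurable_cong_sets[OF refl assms(2)])
  have comp_fst [measurable]: "(\<lambda>p. fst p i) \<in> borel_measurable (X \<Otimes>\<^sub>M M)" if "i < n" for i M
    using measurable_compose[OF measurable_fst comp[OF that]] .
  have comp_snd [measurable]: "(\<lambda>p. snd p i) \<in> borel_measurable (M \<Otimes>\<^sub>M X)" if "i < n" for i M
    using measurable_compose[OF measurable_snd comp[OF that]] .
  \<comment> \<open>The integrals factorise in turn, first over \<open>x'\<close> and then over
    \<open>x\<close>; all coordinates share the law \<nu>, hence a power.\<close>
  have inner: "(\<integral>\<^sup>+x. \<integral>\<^sup>+x'. ennreal (exp (c * g * ?S x x')) \<partial>X \<partial>X)
      = (\<integral>\<^sup>+u. \<integral>\<^sup>+u'. ennreal (exp (c * g * (u * u'))) \<partial>\<nu> \<partial>\<nu>) ^ n" for g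
  proof -
    have "(\<integral>\<^sup>+x'. ennreal (exp (c * g * ?S x x')) \<partial>X) = (\<Prod>i<n. \<integral>\<^sup>+u'. ennreal (exp (c * g * (x i * u'))) \<partial>\<nu>)" for x
    proof -
      have "(\<integral>\<^sup>+x'. ennreal (exp (c * g * ?S x x')) \<partial>X)
          = (\<integral>\<^sup>+x'. (\<Prod>i<n. ennreal (exp (c * g * (x i * x' i)))) \<partial>X)"
        by (simp add: sum_distrib_left exp_sum prod_ennreal)
      also have "\<dots> = (\<Prod>i<n. \<integral>\<^sup>+u'. ennreal (exp (c * g * (x i * u'))) \<partial>\<nu>)"
        unfolding X_def by (intro product_nn_integral_prod finite_lessThan exp_measurable)
      finally show ?thesis .
    qed
    then have "(\<integral>\<^sup>+x. \<integral>\<^sup>+x'. ennreal (exp (c * g * ?S x x')) \<partial>X \<partial>X)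
        = (\<integral>\<^sup>+x. (\<Prod>i<n. \<integral>\<^sup>+u'. ennreal (exp (c * g * (x i * u'))) \<partial>\<nu>) \<partial>X)"
      by simp
    also have "\<dots> = (\<Prod>i<n. \<integral>\<^sup>+u. \<integral>\<^sup>+u'. ennreal (exp (c * g * (u * u'))) \<partial>\<nu> \<partial>\<nu>)"
      unfolding X_def by (intro product_nn_integral_prod) auto
    finally show ?thesis by simp
  qed
  have "(\<integral>\<^sup>+x. \<integral>\<^sup>+x'. ennreal (exp ((c * ?S x x')\<^sup>2 / 2)) \<partial>X \<partial>X)
      = (\<integral>\<^sup>+x. \<integral>\<^sup>+x'. \<integral>\<^sup>+g. ?\<phi> g * ennreal (exp (c * g * ?S x x')) \<partial>lborel \<partial>X \<partial>X)"
  proof (intro nn_integral_cong)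
    fix x x'
    show "ennreal (exp ((c * ?S x x')\<^sup>2 / 2)) = (\<integral>\<^sup>+g. ?\<phi> g * ennreal (exp (c * g * ?S x x')) \<partial>lborel)"
      using nn_integral_exp_normal_density[of 1 0 "c * ?S x x'"] by (simp add: mult_ac)
  qed
  \<comment> \<open>The Gaussian integral moves outwards, here past \<open>x'\<close> and next past
    \<open>x\<close>.\<close>
  also have "\<dots> = (\<integral>\<^sup>+x. \<integral>\<^sup>+g. \<integral>\<^sup>+x'. ?\<phi> g * ennreal (exp (c * g * ?S x x')) \<partial>X \<partial>lborel \<partial>X)"
  proof (intro nn_integral_cong LX.Fubini'[symmetric])
    fix x
    have "(\<lambda>p. ?\<phi> (snd p) * ennreal (exp (c * snd p * ?S x (fst p)))) \<in> borel_measurable (X \<Otimes>\<^sub>M lborel)"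
      by measurable
    then show "(\<lambda>(x', g). ?\<phi> g * ennreal (exp (c * g * ?S x x'))) \<in> borel_measurable (X \<Otimes>\<^sub>M lborel)"
      by (simp add: split_beta')
  qed
  also have "\<dots> = (\<integral>\<^sup>+g. \<integral>\<^sup>+x. \<integral>\<^sup>+x'. ?\<phi> g * ennreal (exp (c * g * ?S x x')) \<partial>X \<partial>X \<partial>lborel)"
  proof (rule LX.Fubini'[symmetric])
    let ?M = "(X \<Otimes>\<^sub>M lborel) \<Otimes>\<^sub>M X"
    have [measurable]: "(\<lambda>q. fst (fst q) i) \<in> borel_measurable ?M" if "i < n" for i
      using measurable_compose[OF measurable_fst comp_fst[OF that]] .
    have "(\<lambda>q. ?\<phi> (snd (fst q)) * ennreal (exp (c * snd (fst q) * ?S (fst (fst q)) (snd q)))) \<in> borel_measurable ?M"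
      by measurable
    then show "(\<lambda>(x, g). \<integral>\<^sup>+x'. ?\<phi> g * ennreal (exp (c * g * ?S x x')) \<partial>X) \<in> borel_measurable (X \<Otimes>\<^sub>M lborel)"
      unfolding split_beta' by (intro X.borel_measurable_nn_integral) (simp add: split_beta')
  qed
  also have "\<dots> = (\<integral>\<^sup>+g. ?\<phi> g * (\<integral>\<^sup>+x. \<integral>\<^sup>+x'. ennreal (exp (c * g * ?S x x')) \<partial>X \<partial>X) \<partial>lborel)"
  proof (rule nn_integral_cong)
    fix g
    have 1: "(\<lambda>x'. ennreal (exp (c * g * ?S x x'))) \<in> borel_measurable X" for x
      by measurable
    have "(\<lambda>q. ennreal (exp (c * g * ?S (fst q) (snd q)))) \<in> borel_measurable (X \<Otimes>\<^sub>M X)"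
      by measurable
    then have "(\<lambda>x. \<integral>\<^sup>+x'. ennreal (exp (c * g * ?S x x')) \<partial>X) \<in> borel_measurable X"
      by (intro X.borel_measurable_nn_integral) (simp add: split_beta')
    then show "(\<integral>\<^sup>+x. \<integral>\<^sup>+x'. ?\<phi> g * ennreal (exp (c * g * ?S x x')) \<partial>X \<partial>X)
        = ?\<phi> g * (\<integral>\<^sup>+x. \<integral>\<^sup>+x'. ennreal (exp (c * g * ?S x x')) \<partial>X \<partial>X)"
      by (simp only: nn_integral_cmult[OF 1] nn_integral_cmult)
  qed
  finally show ?thesis
    by (simp only: inner)
qed

subsection \<open>Contiguity from second moments\<close>

text \<open>A set of small null probability can carry mass under \<open>P n\<close> only where the
  ratio is large, and the second moment limits that part. The level \<open>K\<close> separates the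
  two regimes.\<close>

lemma contiguous_if_second_moment_tendsto:
  assumes prob: "\<And>n. prob_space (P n)" "\<And>n. prob_space (Q n)"
    and sets: "\<And>n. sets (P n) = sets (Q n)"
    and ac: "\<And>n. absolutely_continuous (Q n) (P n)"
    and lim: "(\<lambda>n. lr_second_moment (P n) (Q n)) \<longlonglongrightarrow> ennreal c"
  shows "contiguous P Q"
  unfolding contiguous_def
proof (intro conjI allI impI sets)
  \<comment> \<open>Positive and above the limit whatever the sign of \<open>c\<close>, so the
    second moments are eventually at most \<open>C\<close>.\<close>
  define C where "C = \<bar>c\<bar> + 1"
  have C: "0 < C" "c < C" by (auto simp: C_def)
  have key: "K * measure (P n) A \<le> K\<^sup>2 * measure (Q n) A + C"
    if E: "lr_second_moment (P n) (Q n) \<le> ennreal C" and A: "A \<in> sets (Q n)" and K: "0 \<le> K" for K n A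
  proof -
    interpret P: prob_space "P n" by fact
    interpret Q: prob_space "Q n" by fact
    let ?L = "RN_deriv (Q n) (P n)"
    let ?k = "ennreal K"
    have [measurable]: "A \<in> sets (Q n)" by fact
    have "emeasure (P n) A = emeasure (density (Q n) ?L) A"
      by (simp add: Q.density_RN_deriv[OF ac sets])
    also have "\<dots> = (\<integral>\<^sup>+Y. ?L Y * indicator A Y \<partial>Q n)"
      by (rule emeasure_density) measurable
    finally have "?k * emeasure (P n) A = (\<integral>\<^sup>+Y. ?k * (?L Y * indicator A Y) \<partial>Q n)"
      by (simp add: nn_integral_cmult)
    also have "\<dots> \<le> (\<integral>\<^sup>+Y. ?k\<^sup>2 * indicator A Y + (?L Y)\<^sup>2 \<partial>Q n)"
    proof (rule nn_integral_mono)
      fix Y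
      show "?k * (?L Y * indicator A Y) \<le> ?k\<^sup>2 * indicator A Y + (?L Y)\<^sup>2"
      \<comment> \<open>Below the level the ratio is replaced by \<open>?k\<close>; above it,
        \<open>?k\<close> is replaced by the ratio.\<close>
      proof (cases "?L Y \<le> ?k")
        case True
        then have "?k * (?L Y * indicator A Y) \<le> ?k * (?k * indicator A Y)"
          by (intro mult_left_mono mult_right_mono) auto
        then show ?thesis
          by (simp add: power2_eq_square mult.assoc add_increasing2)
      next
        case False
        then have "?k * (?L Y * indicator A Y) \<le> ?L Y * (?L Y * 1)"
          by (intro mult_mono) (auto split: split_indicator)
        then show ?thesis
          by (simp add: power2_eq_square add_increasing)
      qed
    qed
    also have "\<dots> = ?k\<^sup>2 * emeasure (Q n) A + lr_second_moment (P n) (Q n)"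
      unfolding lr_second_moment_def
      by (subst nn_integral_add) (auto simp: nn_integral_cmult)
    also have "\<dots> \<le> ?k\<^sup>2 * emeasure (Q n) A + ennreal C"
      using E by (intro add_left_mono)
    finally have "ennreal (K * measure (P n) A) \<le> ennreal (K\<^sup>2 * measure (Q n) A + C)"
      using K C by (simp add: P.emeasure_eq_measure Q.emeasure_eq_measure ennreal_mult ennreal_power)
    then show ?thesis
      using K C by (subst (asm) ennreal_le_iff) (auto intro!: add_nonneg_nonneg)
  qed
  have ev: "\<forall>\<^sub>F n in sequentially. lr_second_moment (P n) (Q n) \<le> ennreal C"
    using order_tendstoD(2)[OF lim, of "ennreal C"] C
    by (auto simp: ennreal_less_iff ennreal_lessI elim: eventually_mono)
  fix A assume A: "\<forall>n. A n \<in> sets (Q n)" and A0: "(\<lambda>n. measure (Q n) (A n)) \<longlonglongrightarrow> 0"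
  show "(\<lambda>n. measure (P n) (A n)) \<longlonglongrightarrow> 0"
  proof (rule LIMSEQ_I)
    fix e :: real assume e: "0 < e"
    \<comment> \<open>With this level \<open>C\<close> equals \<open>K * e / 2\<close>, and a null
      probability below \<open>e / (2 * K)\<close> contributes less than the other half of
      \<open>K * e\<close>.\<close>
    define K where "K = 2 * C / e"
    have K: "0 < K" using C e by (simp add: K_def)
    have "\<forall>\<^sub>F n in sequentially. measure (Q n) (A n) < e / (2 * K)"
      using order_tendstoD(2)[OF A0] K e by simp
    with ev have "\<forall>\<^sub>F n in sequentially. norm (measure (P n) (A n) - 0) < e"
    proof eventually_elim
      case (elim n)
      have "K * measure (P n) (A n) \<le> K\<^sup>2 * measure (Q n) (A n) + C"
        using key elim A K by simp
      also have "\<dots> < K\<^sup>2 * (e / (2 * K)) + C"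
        using elim K by (intro add_strict_right_mono mult_strict_left_mono) auto
      also have "\<dots> = K * e"
        using K e C unfolding K_def by (simp add: field_simps power2_eq_square)
      finally show ?case using K by simp
    qed
    then show "\<exists>N. \<forall>n\<ge>N. norm (measure (P n) (A n) - 0) < e"
      by (simp add: eventually_sequentially)
  qed
qed

subsection \<open>Spiked Wigner matrices\<close>

text \<open>The spiked matrix is a Gaussian location mixture on its upper triangle: before division
  by \<open>sqrt n\<close>, the signal at \<open>(i, j)\<close> is
  \<open>sqrt n * l * x i * x j\<close>. Positivity of \<open>n\<close> makes the rescaling
  invertible.\<close>

lemma gwig_second_moment:
  assumes X: "prob_space (\<X> n)" "sets (\<X> n) = sets (vec_space n)" and n: "0 < n"
  shows "absolutely_continuous (gwig n 0 \<X>) (gwig n l \<X>)"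
    and "lr_second_moment (gwig n l \<X>) (gwig n 0 \<X>)
      = (\<integral>\<^sup>+x. \<integral>\<^sup>+x'. ennreal (exp ((sqrt (real n) * l * (\<Sum>i<n. x i * x' i))\<^sup>2 / 2)) \<partial>\<X> n \<partial>\<X> n)"
proof -
  let ?I = "upper_index n"
  let ?G = "gauss_PiM ?I goe_sd"
  let ?m = "\<lambda>x ij. sqrt (real n) * l * (x (fst ij) * x (snd ij))"
  let ?h = "\<lambda>w. \<lambda>(i, j)\<in>{..<n} \<times> {..<n}. w (min i j, max i j)"
  let ?T = "\<lambda>w. \<lambda>(i, j)\<in>{..<n} \<times> {..<n}. w (min i j, max i j) / sqrt (real n)"
  let ?S = "\<lambda>Y. \<lambda>ij\<in>?I. sqrt (real n) * Y ij"
  have goe_upper: "goe_upper n = ?G"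
    by (simp add: goe_upper_def gauss_PiM_def)
  have comp: "(\<lambda>x. x i) \<in> borel_measurable (\<X> n)" if "i < n" for i
    using that measurable_component_singleton[of i "{..<n}" "\<lambda>_. borel :: real measure"]
    by (simp add: vec_space_def measurable_cong_sets[OF X(2) refl])
  have up: "(min i j, max i j) \<in> ?I" if "i < n" "j < n" for i j
    using that by (auto simp: upper_index_def)
  have h: "?h \<in> ?G \<rightarrow>\<^sub>M mat_space n"
    using upper_index_measurable[of n] by (simp add: goe_upper)
  interpret gauss_mixture "\<X> n" ?I goe_sd ?m "mat_space n" ?T ?S
  proof (intro gauss_mixture.intro gauss_mixture_axioms.intro X finite_upper_index)
    show "?T \<in> (\<Pi>\<^sub>M i\<in>?I. borel) \<rightarrow>\<^sub>M mat_space n"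
      unfolding mat_space_def using up
      by (intro measurable_restrict) (auto intro!: borel_measurable_divide measurable_component_singleton)
    show "?S \<in> mat_space n \<rightarrow>\<^sub>M (\<Pi>\<^sub>M i\<in>?I. borel)"
      unfolding mat_space_def
      by (intro measurable_restrict borel_measurable_times borel_measurable_const measurable_component_singleton)
         (auto simp: upper_index_def)
    fix w assume "w \<in> space (\<Pi>\<^sub>M i\<in>?I. (borel :: real measure))"
    then show "?S (?T w) = w"
      using n by (auto simp: space_PiM PiE_def extensional_def fun_eq_iff upper_index_def restrict_def min_def max_def)
  next
    fix ij assume "ij \<in> ?I"
    then show "(\<lambda>x. ?m x ij) \<in> borel_measurable (\<X> n)"
      by (intro borel_measurable_times borel_measurable_const comp) (auto simp: upper_index_def)
  qed auto
  have null: "null_law = gwig n 0 \<X>"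
  proof -
    have "(\<lambda>W. \<lambda>ij\<in>{..<n} \<times> {..<n}. W ij / sqrt (real n)) \<in> mat_space n \<rightarrow>\<^sub>M mat_space n"
      unfolding mat_space_def
      by (intro measurable_restrict borel_measurable_divide measurable_component_singleton) auto
    then show ?thesis
      unfolding null_law_def gwig_0[of \<X> n, OF X] goe_def goe_upper
      by (subst distr_distr[OF _ h]) (auto simp: fun_eq_iff restrict_def intro!: distr_cong)
  qed
  have signal: "signal_law = gwig n l \<X>"
  proof -
    \<comment> \<open>\<open>goe n\<close> is the image of the upper triangle under
      \<open>?h\<close>, so its product with the prior is an image as well and the model map can be
      composed with it.\<close>
    have pair: "\<X> n \<Otimes>\<^sub>M goe n = distr (\<X> n \<Otimes>\<^sub>M ?G) (\<X> n \<Otimes>\<^sub>M mat_space n) (\<lambda>(x, w). (x, ?h w))"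
      using pair_measure_distr[of "\<lambda>x. x" "\<X> n" "\<X> n" ?h ?G "mat_space n"] h
        prob_space_imp_sigma_finite[OF prob_space_goe[of n]]
      by (simp add: goe_def goe_upper)
    have sets: "sets (\<X> n \<Otimes>\<^sub>M goe n) = sets (\<X> n \<Otimes>\<^sub>M mat_space n)"
      by (intro sets_pair_measure_cong) auto
    show ?thesis
      unfolding signal_law_def gwig_def pair
    proof (subst distr_distr)
      show "(\<lambda>(x, W). \<lambda>(i, j)\<in>{..<n} \<times> {..<n}. l * (x i * x j) + W (i, j) / sqrt (real n))
          \<in> \<X> n \<Otimes>\<^sub>M mat_space n \<rightarrow>\<^sub>M mat_space n"
        using gwig_measurable[of \<X> n l, OF X(2)] by (simp add: measurable_cong_sets[OF sets refl])
      show "(\<lambda>(x, w). (x, ?h w)) \<in> \<X> n \<Otimes>\<^sub>M ?G \<rightarrow>\<^sub>M \<X> n \<Otimes>\<^sub>M mat_space n"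
        using h by (auto simp: split_beta' intro!: measurable_Pair measurable_compose[OF measurable_snd])
      show "distr (\<X> n \<Otimes>\<^sub>M ?G) (mat_space n) (\<lambda>(x, w). ?T (\<lambda>ij\<in>?I. w ij + ?m x ij))
        = distr (\<X> n \<Otimes>\<^sub>M ?G) (mat_space n)
          ((\<lambda>(x, W). \<lambda>(i, j)\<in>{..<n} \<times> {..<n}. l * (x i * x j) + W (i, j) / sqrt (real n)) \<circ> (\<lambda>(x, w). (x, ?h w)))"
        using up n
        by (intro distr_cong) (auto simp: fun_eq_iff restrict_def add_divide_distrib min_def max_def)
    qed
  qed
  show "absolutely_continuous (gwig n 0 \<X>) (gwig n l \<X>)"
    using absolutely_continuous_signal_law by (simp only: null signal)
  have "(\<Sum>ij\<in>?I. ?m x ij * ?m x' ij / (goe_sd ij)\<^sup>2) = (sqrt (real n) * l * (\<Sum>i<n. x i * x' i))\<^sup>2 / 2" for x x'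
  proof -
    \<comment> \<open>Regrouping the four factors by index lets the triangle identity apply to
      \<open>x i * x' i\<close>, which produces the squared overlap.\<close>
    have "(\<Sum>ij\<in>?I. ?m x ij * ?m x' ij / (goe_sd ij)\<^sup>2)
        = (sqrt (real n) * l)\<^sup>2 * (\<Sum>ij\<in>?I. (x (fst ij) * x' (fst ij)) * (x (snd ij) * x' (snd ij)) / (goe_sd ij)\<^sup>2)"
      unfolding sum_distrib_left by (intro sum.cong refl) (simp add: power2_eq_square mult_ac)
    then show ?thesis
      by (simp only: sum_upper_index_mult[of "\<lambda>i. x i * x' i"]) (simp add: power_mult_distrib)
  qed
  then show "lr_second_moment (gwig n l \<X>) (gwig n 0 \<X>)
      = (\<integral>\<^sup>+x. \<integral>\<^sup>+x'. ennreal (exp ((sqrt (real n) * l * (\<Sum>i<n. x i * x' i))\<^sup>2 / 2)) \<partial>\<X> n \<partial>\<X> n)"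
    using second_moment_signal_law by (simp only: null signal)
qed

text \<open>The factors \<open>1 / sqrt n\<close> of the two coordinates turn
  \<open>sqrt n * l * g\<close> into \<open>l * g / sqrt n\<close>, the argument of the moment
  generating function of a product of two independent draws from \<pi>.\<close>

lemma gwig_iid_second_moment:
  assumes \<pi>: "prob_space \<pi>" "sets \<pi> = sets borel" and n: "0 < n"
    and int: "\<And>t. integrable (\<pi> \<Otimes>\<^sub>M \<pi>) (\<lambda>p. exp (t * (fst p * snd p)))"
  shows "lr_second_moment (gwig n l (iid_prior \<pi>)) (gwig n 0 (iid_prior \<pi>))
    = (\<integral>\<^sup>+g. ennreal (std_normal_density g) *
        ennreal ((\<integral>p. exp (l * g / sqrt (real n) * (fst p * snd p)) \<partial>(\<pi> \<Otimes>\<^sub>M \<pi>)) ^ n) \<partial>lborel)"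
proof -
  interpret p: prob_space \<pi> by fact
  interpret pair_sigma_finite \<pi> \<pi>
    by (intro pair_sigma_finite.intro p.sigma_finite_measure_axioms)
  note [measurable_cong] = \<pi>(2)
  let ?\<nu> = "distr \<pi> borel (\<lambda>t. t / sqrt (real n))"
  let ?c = "sqrt (real n) * l"
  have [measurable]: "(\<lambda>t. t / sqrt (real n)) \<in> \<pi> \<rightarrow>\<^sub>M borel" by measurable
  have \<nu>: "prob_space ?\<nu>" by (rule p.prob_space_distr) measurable
  interpret \<nu>: prob_space ?\<nu> by fact
  have "(\<integral>\<^sup>+u. \<integral>\<^sup>+u'. ennreal (exp (?c * g * (u * u'))) \<partial>?\<nu> \<partial>?\<nu>)
      = ennreal (\<integral>p. exp (l * g / sqrt (real n) * (fst p * snd p)) \<partial>(\<pi> \<Otimes>\<^sub>M \<pi>))" for g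
  proof -
    have "(\<integral>\<^sup>+u. \<integral>\<^sup>+u'. ennreal (exp (?c * g * (u * u'))) \<partial>?\<nu> \<partial>?\<nu>)
        = (\<integral>\<^sup>+u. \<integral>\<^sup>+y. ennreal (exp (?c * g * (u * (y / sqrt (real n))))) \<partial>\<pi> \<partial>?\<nu>)"
      by (subst nn_integral_distr) measurable
    also have "\<dots> = (\<integral>\<^sup>+x. \<integral>\<^sup>+y. ennreal (exp (?c * g * (x / sqrt (real n) * (y / sqrt (real n))))) \<partial>\<pi> \<partial>\<pi>)"
      by (subst nn_integral_distr) measurable
    also have "\<dots> = (\<integral>\<^sup>+x. \<integral>\<^sup>+y. ennreal (exp (l * g / sqrt (real n) * (x * y))) \<partial>\<pi> \<partial>\<pi>)"
    proof -
      have "r * l * g * (x / r * (y / r)) = l * g / r * (x * y)" if "r \<noteq> 0" for r x y :: real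
        using that by (simp add: field_simps)
      moreover have "sqrt (real n) \<noteq> 0" using n by simp
      ultimately show ?thesis by presburger
    qed
    also have "\<dots> = (\<integral>\<^sup>+p. ennreal (exp (l * g / sqrt (real n) * (fst p * snd p))) \<partial>(\<pi> \<Otimes>\<^sub>M \<pi>))"
      by (subst p.nn_integral_fst[symmetric]) auto
    also have "\<dots> = ennreal (\<integral>p. exp (l * g / sqrt (real n) * (fst p * snd p)) \<partial>(\<pi> \<Otimes>\<^sub>M \<pi>))"
      by (intro nn_integral_eq_integral int) simp
    finally show ?thesis .
  qed
  then show ?thesis
    unfolding gwig_second_moment(2)[of "iid_prior \<pi>", OF prob_space_iid_prior[OF \<pi>] sets_iid_prior n]
    unfolding iid_prior_def nn_integral_exp_overlap_square[OF \<nu> sets_distr]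
    by (simp add: ennreal_power)
qed

theorem theorem3p9:
  fixes \<pi> :: "real measure" and l \<sigma> :: real
    and P Q :: "nat \<Rightarrow> (nat \<times> nat \<Rightarrow> real) measure"
  assumes "prob_space \<pi>" and "sets \<pi> = sets borel"
    and "integrable \<pi> (\<lambda>x. x)" and "prob_space.expectation \<pi> (\<lambda>x. x) = 0"
    and "integrable \<pi> (\<lambda>x. x\<^sup>2)" and "prob_space.variance \<pi> (\<lambda>x. x) = 1"
    and "l \<ge> 0"
    and "\<And>n. P n = gwig n l (iid_prior \<pi>)"
    and "\<And>n. Q n = gwig n 0 (iid_prior \<pi>)"
    and "\<sigma> > 0"
    and "subgaussian (\<pi> \<Otimes>\<^sub>M \<pi>) (\<lambda>(x, y). x * y) (\<sigma>\<^sup>2)"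
    and "l < 1 / \<sigma>"
  shows "(\<forall>n. absolutely_continuous (Q n) (P n)) \<and>
         (\<lambda>n. lr_second_moment (P n) (Q n)) \<longlonglongrightarrow> 1 / ennreal (sqrt (1 - l\<^sup>2)) \<and>
         1 / ennreal (sqrt (1 - l\<^sup>2)) < \<infinity> \<and>
         contiguous P Q"
proof -
  note \<pi> = assms(1,2)
  interpret prob_space \<pi> by fact
  interpret pair_prob_space \<pi> \<pi>
    by (intro pair_prob_space.intro pair_sigma_finite.intro sigma_finite_measure_axioms prob_space_axioms)
  note [measurable_cong] = \<pi>(2)
  let ?Z = "\<lambda>p::real \<times> real. fst p * snd p"
  define F where "F t = (\<integral>p. exp (t * ?Z p) \<partial>(\<pi> \<Otimes>\<^sub>M \<pi>))" for t
  have Z [measurable]: "?Z \<in> borel_measurable (\<pi> \<Otimes>\<^sub>M \<pi>)" by measurable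
  have sg: "integrable (\<pi> \<Otimes>\<^sub>M \<pi>) ?Z" "(\<integral>p. ?Z p \<partial>(\<pi> \<Otimes>\<^sub>M \<pi>)) = 0"
      "integrable (\<pi> \<Otimes>\<^sub>M \<pi>) (\<lambda>p. exp (t * ?Z p))" "F t \<le> exp (\<sigma>\<^sup>2 * t\<^sup>2 / 2)" for t
    using assms(11) by (auto simp: subgaussian_def split_beta' F_def)
  \<comment> \<open>Finite exponential moments give the square integrability that Fubini requires
    below.\<close>
  have Z2: "integrable (\<pi> \<Otimes>\<^sub>M \<pi>) (\<lambda>p. (?Z p)\<^sup>2)"
  proof (rule Bochner_Integration.integrable_bound)
    show "integrable (\<pi> \<Otimes>\<^sub>M \<pi>) (\<lambda>p. 2 * (exp (1 * ?Z p) + exp (- 1 * ?Z p)))"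
      by (intro integrable_mult_right Bochner_Integration.integrable_add sg)
    have "y\<^sup>2 \<le> 2 * (exp y + exp (- y))" for y :: real
    proof -
      have "exp \<bar>y\<bar> \<le> exp y + exp (- y)" by (cases "0 \<le> y") (simp_all add: abs_if)
      with power2_le_exp_abs[of y] show ?thesis by simp
    qed
    then show "AE p in \<pi> \<Otimes>\<^sub>M \<pi>. norm ((?Z p)\<^sup>2) \<le> norm (2 * (exp (1 * ?Z p) + exp (- 1 * ?Z p)))"
      by (intro AE_I2) (simp add: abs_of_nonneg add_nonneg_nonneg)
  qed measurable
  have var: "(\<integral>x. x\<^sup>2 \<partial>\<pi>) = 1"
    using assms(4,6) by simp
  \<comment> \<open>By independence this is the square of the second moment of \<pi>.\<close>
  have "(\<integral>p. (?Z p)\<^sup>2 \<partial>(\<pi> \<Otimes>\<^sub>M \<pi>)) = (\<integral>x. \<integral>y. (x * y)\<^sup>2 \<partial>\<pi> \<partial>\<pi>)"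
    using integral_fst'[of "\<lambda>p. (?Z p)\<^sup>2"] Z2 by simp
  also have "\<dots> = 1"
    by (simp add: power_mult_distrib var)
  finally have EZ2: "(\<integral>p. (?Z p)\<^sup>2 \<partial>(\<pi> \<Otimes>\<^sub>M \<pi>)) = 1" .
  have clt: "(\<lambda>n. F (t / sqrt (real n)) ^ n) \<longlonglongrightarrow> exp (t\<^sup>2 / 2)" for t
    unfolding F_def by (intro P.mgf_power_tendsto Z sg EZ2)
  have F0: "0 \<le> F t" for t
    by (simp add: F_def)
  \<comment> \<open>At \<open>t = 1\<close> the powers tend to \<open>exp (1 / 2)\<close>, while the
    sub-Gaussian bound keeps them below \<open>exp (\<sigma>\<^sup>2 / 2)\<close>. Hence the
    variance proxy is at least 1, and \<open>l * \<sigma> < 1\<close> then forces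
    \<open>l\<^sup>2 < 1\<close>.\<close>
  have "exp (1\<^sup>2 / 2) \<le> exp (\<sigma>\<^sup>2 / 2)"
  proof (rule LIMSEQ_le_const2[OF clt[of 1]], intro exI allI impI)
    fix n :: nat assume n: "1 \<le> n"
    have "F (1 / sqrt (real n)) ^ n \<le> exp (\<sigma>\<^sup>2 * (1 / sqrt (real n))\<^sup>2 / 2) ^ n"
      by (intro power_mono sg F0)
    also have "\<dots> = exp (\<sigma>\<^sup>2 / 2)"
      using n by (simp add: exp_of_nat_mult[symmetric] power_divide)
    finally show "F (1 / sqrt (real n)) ^ n \<le> exp (\<sigma>\<^sup>2 / 2)" .
  qed
  then have \<sigma>: "1 \<le> \<sigma>\<^sup>2" by simp
  have "l * \<sigma> < 1"
    using assms(10,12) by (simp add: field_simps)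
  then have l\<sigma>: "l\<^sup>2 * \<sigma>\<^sup>2 < 1"
    using assms(7,10) by (simp add: power_mult_distrib[symmetric] power_less_one_iff abs_square_less_1)
  have "l\<^sup>2 * 1 \<le> l\<^sup>2 * \<sigma>\<^sup>2"
    using \<sigma> by (intro mult_left_mono) auto
  with l\<sigma> have l: "l\<^sup>2 < 1" by simp
  have lim: "(\<lambda>n. lr_second_moment (P n) (Q n)) \<longlonglongrightarrow> ennreal (1 / sqrt (1 - l\<^sup>2))"
  proof (rule Lim_transform_eventually)
    show "(\<lambda>n. \<integral>\<^sup>+g. ennreal (std_normal_density g) * ennreal (F (l * g / sqrt (real n)) ^ n) \<partial>lborel)
        \<longlonglongrightarrow> ennreal (1 / sqrt (1 - l\<^sup>2))"
    proof (rule nn_integral_mgf_power_tendsto[where v = "\<sigma>\<^sup>2"])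
      show "F \<in> borel_measurable borel"
        unfolding F_def by measurable
    qed (use F0 sg clt l\<sigma> l in auto)
    show "\<forall>\<^sub>F n in sequentially.
        (\<integral>\<^sup>+g. ennreal (std_normal_density g) * ennreal (F (l * g / sqrt (real n)) ^ n) \<partial>lborel)
          = lr_second_moment (P n) (Q n)"
      using eventually_gt_at_top[of 0]
      by eventually_elim (simp add: assms(8,9) F_def gwig_iid_second_moment[OF \<pi> _ sg(3)])
  qed
  have ac: "absolutely_continuous (Q n) (P n)" for n
  \<comment> \<open>For \<open>n = 0\<close> the index set is empty, so the observation is a
    constant map in which \<open>l\<close> does not occur.\<close>
  proof (cases "n = 0")
    case True
    then have "P n = Q n" by (simp add: assms(8,9) gwig_def restrict_def)
    then show ?thesis by (simp add: absolutely_continuous_def)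
  next
    case False
    then show ?thesis
      using gwig_second_moment(1)[of "iid_prior \<pi>", OF prob_space_iid_prior[OF \<pi>] sets_iid_prior]
      by (simp add: assms(8,9))
  qed
  have "contiguous P Q"
    using ac lim
    by (intro contiguous_if_second_moment_tendsto)
       (simp_all add: assms(8,9) prob_space_gwig prob_space_iid_prior[OF \<pi>])
  moreover have "1 / ennreal (sqrt (1 - l\<^sup>2)) = ennreal (1 / sqrt (1 - l\<^sup>2))"
    using l divide_ennreal[of 1 "sqrt (1 - l\<^sup>2)"] by simp
  ultimately show ?thesis
    using ac lim by simp
qed

end
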